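(* Let $(X_1,d_{X_1}),\dots,(X_n,d_{X_n})$ be metric spaces and let $P=X_1\times\cdots\times X_n$. The following conditions are equivalent for every metric $d$ on $P$. (i) $d$ is an isotone metric product and has an isotone continuation. (ii) $d$ is distance-increasing and the identical mapping $P\ni(x_1,\dots,x_n)\mapsto(x_1,\dots,x_n)\in P$ is bornologous as a mapping from $(P,\rho_\infty)$ to $(P,d)$.
   Context: $\mathbb{R}_+=[0,\infty)$, $n\ge 1$. For $\bar{x},\bar{y}\in\mathbb{R}^n_+$, $\bar{x}\leqslant\bar{y}$ means $x_i\leqslant y_i$ for every $i$. For $A\subseteq\mathbb{R}^n_+$, a function $f:A\to\mathbb{R}_+$ is isotone if $\bar{x}\leqslant\bar{y}$ implies $f(\bar{x})\leqslant f(\bar{y})$ for all $\bar{x},\bar{y}\in A$. The distance set of a metric space $(X,d_X)$ is $D_X=\{d_X(x,y):x,y\in X\}$. A metric $d$ on $P$ is an isotone metric product if there is an isotone function $\Phi:D_{X_1}\times\cdots\times D_{X_n}\to\mathbb{R}_+$ such that $d((x_1,\dots,x_n),(y_1,\dots,y_n))=\Phi(d_{X_1}(x_1,y_1),\dots,d_{X_n}(x_n,y_n))$ for all $(x_1,\dots,x_n),(y_1,\dots,y_n)\in P$. It has an isotone continuation if there is an isotone function $\Phi:\mathbb{R}^n_+\to\mathbb{R}_+$ for which the same equality holds for all points of $P$. A metric $d$ on $P$ is distance-increasing if $d((x_1,\dots,x_n),(y_1,\dots,y_n))\leqslant d((\tilde{x}_1,\dots,\tilde{x}_n),(\tilde{y}_1,\dots,\tilde{y}_n))$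 whenever $(d_{X_1}(x_1,y_1),\dots,d_{X_n}(x_n,y_n))\leqslant(d_{X_1}(\tilde{x}_1,\tilde{y}_1),\dots,d_{X_n}(\tilde{x}_n,\tilde{y}_n))$. The metric $\rho_\infty$ on $P$ is $\rho_\infty((x_1,\dots,x_n),(y_1,\dots,y_n))=\max_{1\leqslant i\leqslant n}d_{X_i}(x_i,y_i)$. A mapping $f:(X,d)\to(Y,\rho)$ of metric spaces is bornologous if for every $\varepsilon\in\mathbb{R}_+$ there is $\delta\in\mathbb{R}_+$ such that $d(x,y)\leqslant\varepsilon$ implies $\rho(f(x),f(y))\leqslant\delta$ for all $x,y\in X$. *)

theory Defs
  imports "HOL-Analysis.Analysis"
begin

text \<open>
  The number of factors is \<open>n = CARD('n)\<close>, an arbitrary positive integer. The factors are carriers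
  \<open>X i\<close> in a common type \<open>'a\<close> (any finite family of types embeds into their sum type), possibly empty.
  The order \<open>\<le>\<close> on \<open>real ^ 'n\<close> is the componentwise one, so \<open>{0..} :: (real ^ 'n) set\<close> is
  the nonnegative orthant.
\<close>

definition prod_carrier :: "('n::finite \<Rightarrow> 'a set) \<Rightarrow> ('a ^ 'n) set" where
  "prod_carrier X = {x. \<forall>i. x $ i \<in> X i}"

definition dist_set :: "'a set \<Rightarrow> ('a \<Rightarrow> 'a \<Rightarrow> real) \<Rightarrow> real set" where
  "dist_set M dM = {dM x y | x y. x \<in> M \<and> y \<in> M}"

definition dist_vec :: "('n::finite \<Rightarrow> 'a \<Rightarrow> 'a \<Rightarrow> real) \<Rightarrow> 'a ^ 'n \<Rightarrow> 'a ^ 'n \<Rightarrow> real ^ 'n" where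
  "dist_vec dX x y = (\<chi> i. dX i (x $ i) (y $ i))"

definition isotone_on :: "(real ^ 'n::finite) set \<Rightarrow> (real ^ 'n \<Rightarrow> real) \<Rightarrow> bool" where
  "isotone_on A f \<longleftrightarrow> f \<in> A \<rightarrow> {0..} \<and> mono_on A f"

definition isotone_metric_product ::
  "('n::finite \<Rightarrow> 'a set) \<Rightarrow> ('n \<Rightarrow> 'a \<Rightarrow> 'a \<Rightarrow> real) \<Rightarrow> ('a ^ 'n \<Rightarrow> 'a ^ 'n \<Rightarrow> real) \<Rightarrow> bool" where
  "isotone_metric_product X dX d \<longleftrightarrow>
     (\<exists>\<Phi>. isotone_on (prod_carrier (\<lambda>i. dist_set (X i) (dX i))) \<Phi> \<and>
          (\<forall>x \<in> prod_carrier X. \<forall>y \<in> prod_carrier X. d x y = \<Phi> (dist_vec dX x y)))"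

definition has_isotone_continuation ::
  "('n::finite \<Rightarrow> 'a set) \<Rightarrow> ('n \<Rightarrow> 'a \<Rightarrow> 'a \<Rightarrow> real) \<Rightarrow> ('a ^ 'n \<Rightarrow> 'a ^ 'n \<Rightarrow> real) \<Rightarrow> bool" where
  "has_isotone_continuation X dX d \<longleftrightarrow>
     (\<exists>\<Phi>. isotone_on {0..} \<Phi> \<and>
          (\<forall>x \<in> prod_carrier X. \<forall>y \<in> prod_carrier X. d x y = \<Phi> (dist_vec dX x y)))"

definition distance_increasing ::
  "('n::finite \<Rightarrow> 'a set) \<Rightarrow> ('n \<Rightarrow> 'a \<Rightarrow> 'a \<Rightarrow> real) \<Rightarrow> ('a ^ 'n \<Rightarrow> 'a ^ 'n \<Rightarrow> real) \<Rightarrow> bool" where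
  "distance_increasing X dX d \<longleftrightarrow>
     (\<forall>x \<in> prod_carrier X. \<forall>y \<in> prod_carrier X. \<forall>x' \<in> prod_carrier X. \<forall>y' \<in> prod_carrier X.
        dist_vec dX x y \<le> dist_vec dX x' y' \<longrightarrow> d x y \<le> d x' y')"

definition rho_infty :: "('n::finite \<Rightarrow> 'a \<Rightarrow> 'a \<Rightarrow> real) \<Rightarrow> 'a ^ 'n \<Rightarrow> 'a ^ 'n \<Rightarrow> real" where
  "rho_infty dX x y = (MAX i. dX i (x $ i) (y $ i))"

definition bornologous ::
  "'a set \<Rightarrow> ('a \<Rightarrow> 'a \<Rightarrow> real) \<Rightarrow> 'b set \<Rightarrow> ('b \<Rightarrow> 'b \<Rightarrow> real) \<Rightarrow> ('a \<Rightarrow> 'b) \<Rightarrow> bool" where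
  "bornologous M d N \<rho> f \<longleftrightarrow> f \<in> M \<rightarrow> N \<and>
     (\<forall>\<epsilon>\<ge>0. \<exists>\<delta>\<ge>0. \<forall>x\<in>M. \<forall>y\<in>M. d x y \<le> \<epsilon> \<longrightarrow> \<rho> (f x) (f y) \<le> \<delta>)"

lemma Metric_space_rho_infty:
  fixes X :: "'n::finite \<Rightarrow> 'a set"
  assumes "\<And>i. Metric_space (X i) (dX i)"
  shows "Metric_space (prod_carrier X) (rho_infty dX)"
proof
  note ms = assms
  have ge: "dX i (x $ i) (y $ i) \<le> rho_infty dX x y" for i x y
    unfolding rho_infty_def by (rule Max_ge) auto
  have nn: "0 \<le> dX i a b" for i a b
    using Metric_space.nonneg[OF ms] .
  show nonneg: "0 \<le> rho_infty dX x y" for x y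
    using ge nn order_trans by blast
  show "rho_infty dX x y = rho_infty dX y x" for x y
    unfolding rho_infty_def using Metric_space.commute[OF ms] by metis
  have le_iff: "rho_infty dX x y \<le> c \<longleftrightarrow> (\<forall>i. dX i (x $ i) (y $ i) \<le> c)" for x y c
    unfolding rho_infty_def by (subst Max_le_iff) auto
  show "(rho_infty dX x y = 0) = (x = y)" if "x \<in> prod_carrier X" "y \<in> prod_carrier X" for x y
  proof -
    have "(rho_infty dX x y = 0) = (rho_infty dX x y \<le> 0)"
      using nonneg[of x y] by auto
    also have "\<dots> = (\<forall>i. dX i (x $ i) (y $ i) = 0)"
      unfolding le_iff using nn by (auto intro: antisym)
    also have "\<dots> = (x = y)"
      using that Metric_space.zero[OF ms] by (simp add: prod_carrier_def vec_eq_iff)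
    finally show ?thesis .
  qed
  show "rho_infty dX x z \<le> rho_infty dX x y + rho_infty dX y z"
    if "x \<in> prod_carrier X" "y \<in> prod_carrier X" "z \<in> prod_carrier X" for x y z
    unfolding le_iff
  proof
    fix i
    have "dX i (x $ i) (z $ i) \<le> dX i (x $ i) (y $ i) + dX i (y $ i) (z $ i)"
      using that Metric_space.triangle[OF ms] by (simp add: prod_carrier_def)
    then show "dX i (x $ i) (z $ i) \<le> rho_infty dX x y + rho_infty dX y z"
      using ge[of i x y] ge[of i y z] by linarith
  qed
qed

end

(* A distance-increasing metric d extends to the whole orthant as
   \<Phi> t = sup {d x y | dist_vec dX x y \<le> t}. The bornologous condition is precisely what makes
   this supremum finite: dist_vec dX x y \<le> t bounds rho_infty dX x y by the largest entry of t.
   Conversely, an isotone \<Phi> bounds d x y by \<Phi> (\<epsilon>, ..., \<epsilon>) whenever rho_infty dX x y \<le> \<epsilon>. *)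
theory Submission
  imports Defs
begin

text \<open>A maximum is bounded by \<open>c\<close> iff every entry is. This turns balls of
  \<open>rho_infty\<close> into the componentwise order, the language in which isotone functions are
  given.\<close>

lemma rho_infty_le_iff: "rho_infty dX x y \<le> c \<longleftrightarrow> dist_vec dX x y \<le> (\<chi> i. c)"
  unfolding rho_infty_def dist_vec_def less_eq_vec_def by (subst Max_le_iff) auto

text \<open>\<open>Metric_space\<close> postulates nonnegativity for all arguments, also outside the
  carrier, so \<open>x\<close> and \<open>y\<close> may be arbitrary.\<close>

lemma dist_vec_nonneg:
  assumes "\<And>i. Metric_space (X i) (dX i)"
  shows "0 \<le> dist_vec dX x y"
  using Metric_space.nonneg[OF assms] by (simp add: dist_vec_def less_eq_vec_def)

lemma prod_dist_set_subset:
  fixes X :: "'n::finite \<Rightarrow> 'a set"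
  assumes "\<And>i. Metric_space (X i) (dX i)"
  shows "prod_carrier (\<lambda>i. dist_set (X i) (dX i)) \<subseteq> {0..}"
proof
  fix t assume t: "t \<in> prod_carrier (\<lambda>i. dist_set (X i) (dX i))"
  have "0 \<le> t $ i" for i
  proof -
    obtain a b where "t $ i = dX i a b"
      using t unfolding prod_carrier_def dist_set_def by blast
    then show ?thesis using Metric_space.nonneg[OF assms] by simp
  qed
  then show "t \<in> {0..}" by (simp add: less_eq_vec_def)
qed

lemma isotone_on_subset: "isotone_on A f \<Longrightarrow> B \<subseteq> A \<Longrightarrow> isotone_on B f"
  unfolding isotone_on_def by (auto intro: mono_on_subset)

text \<open>The same \<Phi> serves as witness: distance sets consist of nonnegative reals, so it
  only has to be restricted from the orthant.\<close>

lemma isotone_continuation_imp_isotone_metric_product: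
  assumes "\<And>i. Metric_space (X i) (dX i)" and "has_isotone_continuation X dX d"
  shows "isotone_metric_product X dX d"
  using assms(2) isotone_on_subset[OF _ prod_dist_set_subset[of X dX, OF assms(1)]]
  unfolding isotone_metric_product_def has_isotone_continuation_def by blast

lemma isotone_continuation_imp:
  assumes X: "\<And>i. Metric_space (X i) (dX i)" and "has_isotone_continuation X dX d"
  shows "distance_increasing X dX d"
    and "bornologous (prod_carrier X) (rho_infty dX) (prod_carrier X) d (\<lambda>x. x)"
proof -
  obtain \<Phi> where \<Phi>: "\<Phi> \<in> {0..} \<rightarrow> {0..}" "mono_on {0..} \<Phi>"
    and d: "\<And>x y. x \<in> prod_carrier X \<Longrightarrow> y \<in> prod_carrier X \<Longrightarrow> d x y = \<Phi> (dist_vec dX x y)"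
    using assms(2) unfolding has_isotone_continuation_def isotone_on_def by blast
  note dist_vec_nonneg = dist_vec_nonneg[of X dX, OF X]
  \<comment> \<open>Any such \<open>t\<close> lies in the orthant, being above a distance vector.
    Taking another distance vector for \<open>t\<close> gives the first claim, a constant vector the
    second.\<close>
  have mono: "\<Phi> (dist_vec dX x y) \<le> \<Phi> t" if "dist_vec dX x y \<le> t" for x y t
    using \<Phi>(2) dist_vec_nonneg that order_trans[OF dist_vec_nonneg that] by (simp add: mono_on_def)
  show "distance_increasing X dX d"
    unfolding distance_increasing_def by (simp add: d mono)
  show "bornologous (prod_carrier X) (rho_infty dX) (prod_carrier X) d (\<lambda>x. x)"
    unfolding bornologous_def rho_infty_le_iff
  proof (intro conjI allI impI)
    fix \<epsilon> :: real assume "0 \<le> \<epsilon>"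
    then have "0 \<le> \<Phi> (\<chi> i. \<epsilon>)"
      using \<Phi>(1) by (simp add: Pi_iff less_eq_vec_def)
    then show "\<exists>\<delta>\<ge>0. \<forall>x\<in>prod_carrier X. \<forall>y\<in>prod_carrier X.
        dist_vec dX x y \<le> (\<chi> i. \<epsilon>) \<longrightarrow> d x y \<le> \<delta>"
      by (intro exI[of _ "\<Phi> (\<chi> i. \<epsilon>)"]) (simp add: d mono)
  qed auto
qed

lemma has_isotone_continuationI:
  fixes X :: "'n::finite \<Rightarrow> 'a set"
  assumes d: "Metric_space (prod_carrier X) d"
    and inc: "distance_increasing X dX d"
    and born: "bornologous (prod_carrier X) (rho_infty dX) (prod_carrier X) d (\<lambda>x. x)"
  shows "has_isotone_continuation X dX d"
proof -
  \<comment> \<open>The element 0 keeps the supremum meaningful when some factor is empty.\<close>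
  define S where
    "S t = insert 0 {d x y | x y. x \<in> prod_carrier X \<and> y \<in> prod_carrier X \<and> dist_vec dX x y \<le> t}" for t
  have bdd: "bdd_above (S t)" if "0 \<le> t" for t
  proof -
    define \<epsilon> where "\<epsilon> = (MAX i. t $ i)"
    have t_le: "t \<le> (\<chi> i. \<epsilon>)"
      unfolding \<epsilon>_def less_eq_vec_def by auto
    \<comment> \<open>Chaining 0 \<le> \<open>t\<close> with \<open>t_le\<close> at any index gives
      the sign that \<open>bornologous\<close> demands of its radius.\<close>
    then have "0 \<le> \<epsilon>"
      using that order_trans[of 0 t "\<chi> i. \<epsilon>"] by (simp add: less_eq_vec_def)
    then obtain \<delta> where "0 \<le> \<delta>" and \<delta>: "\<And>x y. x \<in> prod_carrier X \<Longrightarrow> y \<in> prod_carrier X \<Longrightarrow>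
        dist_vec dX x y \<le> (\<chi> i. \<epsilon>) \<Longrightarrow> d x y \<le> \<delta>"
      using born unfolding bornologous_def rho_infty_le_iff by blast
    then show ?thesis
      using order_trans[OF _ t_le] by (intro bdd_aboveI[of _ \<delta>]) (auto simp: S_def)
  qed
  have "0 \<le> Sup (S t)" if "0 \<le> t" for t
    using cSup_upper[OF _ bdd[OF that], of 0] by (simp add: S_def)
  \<comment> \<open>Raising the bound from \<open>s\<close> to \<open>t\<close> only admits more
    pairs of points, so the sets are nested.\<close>
  moreover have "Sup (S s) \<le> Sup (S t)" if "0 \<le> s" "s \<le> t" for s t
  proof (rule cSup_subset_mono)
    show "bdd_above (S t)" using that by (intro bdd) auto
    show "S s \<subseteq> S t" using order_trans[OF _ \<open>s \<le> t\<close>] unfolding S_def by blast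
  qed (simp add: S_def)
  ultimately have "isotone_on {0..} (\<lambda>t. Sup (S t))"
    by (auto simp: isotone_on_def mono_on_def)
  moreover have "d x y = Sup (S (dist_vec dX x y))"
    if "x \<in> prod_carrier X" "y \<in> prod_carrier X" for x y
  \<comment> \<open>At a distance vector the supremum is attained by the pair \<open>x\<close>,
    \<open>y\<close> itself: \<open>inc\<close> bounds the other pairs, and nonnegativity of
    \<open>d\<close> handles the inserted 0.\<close>
  proof (rule sym, rule cSup_eq_maximum)
    show "d x y \<in> S (dist_vec dX x y)" using that by (auto simp: S_def)
    show "z \<le> d x y" if "z \<in> S (dist_vec dX x y)" for z
      using that \<open>x \<in> _\<close> \<open>y \<in> _\<close> inc Metric_space.nonneg[OF d]
      unfolding S_def distance_increasing_def by blast
  qed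
  ultimately show ?thesis unfolding has_isotone_continuation_def by blast
qed

theorem theorem3p5:
  fixes X :: "'n::finite \<Rightarrow> 'a set"
    and dX :: "'n \<Rightarrow> 'a \<Rightarrow> 'a \<Rightarrow> real"
    and d :: "'a ^ 'n \<Rightarrow> 'a ^ 'n \<Rightarrow> real"
  assumes "\<And>i. Metric_space (X i) (dX i)"
    and "Metric_space (prod_carrier X) d"
  shows "(isotone_metric_product X dX d \<and> has_isotone_continuation X dX d) \<longleftrightarrow>
    (distance_increasing X dX d \<and>
     bornologous (prod_carrier X) (rho_infty dX) (prod_carrier X) d (\<lambda>x. x))"
  using isotone_continuation_imp[of X dX d, OF assms(1)]
    isotone_continuation_imp_isotone_metric_product[of X dX d, OF assms(1)]
    has_isotone_continuationI[OF assms(2)]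
  by blast

end
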